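(* Let $z_1,\dots,z_n\in\mathbb{C}$ be pairwise distinct, let $m_1,\dots,m_n$ be nonnegative integers, $|M|=m_1+\dots+m_n$, and let $k$ be an integer with $1\le k\le |M|/2$. There is a one-to-one correspondence between the orbits (under permutations of $t_1,\dots,t_k$) of critical points with non-zero critical value of the function $$\Phi(t)=\prod_{i=1}^k\prod_{l=1}^n(t_i-z_l)^{-m_l}\prod_{1\le i<j\le k}(t_i-t_j)^2$$ of $t=(t_1,\dots,t_k)$ and the nondegenerate planes of order $k$ and of degree $|M|+1-k$ having Wronskian $$W(x)=(x-z_1)^{m_1}\cdots(x-z_n)^{m_n}.$$
   Context: $\Phi$ is considered on the set of $t\in\mathbb{C}^k$ such that no $t_i$ is a root of $W$; its critical points with non-zero critical value are the points $t$ with $\Phi(t)\ne0$ and $\frac{1}{\Phi(t)}\frac{\partial\Phi}{\partial t_i}(t)=0$ for $i=1,\dots,k$. "Planes" are two-dimensional linear subspaces of the vector space of complex polynomials of degree at most $d$ in one variable $x$ (for some $d$). The degree $b$ of a plane $V$ is the maximal degree of its polynomials, and its order $a$ is the minimal degree of its nonzero polynomials (so $a<b$). Polynomials of the smaller degree in $V$ are those of degree $a$ (they are all proportional). Choosing monic $F,G\in V$ of degrees $a$ and $b$, the Wronskian of $V$ is the monic polynomial $W_V(x)=\frac{F'(x)G(x)-F(x)G'(x)}{a-b}$ (independent of the choice). A plane $V$ is generic if for every $x_0\in\mathbb{C}$ there is $P\in V$ with $P(x_0)\neq0$; a generic plane is nondegenerate if the polynomials of the smaller degree in $V$ have no multiple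 roots. *)

theory Defs
  imports
    "HOL-Analysis.Analysis"
    "HOL-Computational_Algebra.Polynomial"
    "HOL-Combinatorics.Permutations"
    "HOL-Library.FuncSet"
begin

text \<open>The integers \<open>m\<^sub>l\<close> and the points \<open>z\<^sub>l\<close> are indexed by \<open>l \<in> {1..n}\<close>. A point
  \<open>t\<close> of complex \<open>k\<close>-space is a function on \<open>{1..k}\<close>, extended by \<open>undefined\<close>
  so that points are determined by their \<open>k\<close> coordinates.\<close>

definition W_poly :: "nat \<Rightarrow> (nat \<Rightarrow> complex) \<Rightarrow> (nat \<Rightarrow> nat) \<Rightarrow> complex poly" where
  "W_poly n z m = (\<Prod>l = 1..n. [:- z l, 1:] ^ m l)"

definition Phi ::
  "nat \<Rightarrow> (nat \<Rightarrow> complex) \<Rightarrow> (nat \<Rightarrow> nat) \<Rightarrow> nat \<Rightarrow> (nat \<Rightarrow> complex) \<Rightarrow> complex" where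
  "Phi n z m k t =
     (\<Prod>i = 1..k. \<Prod>l = 1..n. (t i - z l) powi (- int (m l)))
     * (\<Prod>(i, j) \<in> {(i, j). 1 \<le> i \<and> i < j \<and> j \<le> k}. (t i - t j)\<^sup>2)"

definition Phi_domain ::
  "nat \<Rightarrow> (nat \<Rightarrow> complex) \<Rightarrow> (nat \<Rightarrow> nat) \<Rightarrow> nat \<Rightarrow> (nat \<Rightarrow> complex) set" where
  "Phi_domain n z m k =
     {t \<in> {1..k} \<rightarrow>\<^sub>E UNIV. \<forall>i\<in>{1..k}. poly (W_poly n z m) (t i) \<noteq> 0}"

text \<open>The partial derivative of \<open>f\<close> with respect to the \<open>i\<close>-th coordinate. As a function of a
  single coordinate \<open>Phi\<close> is holomorphic near every point of its domain, so \<open>deriv\<close> never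
  returns an arbitrary value below.\<close>

definition partial_deriv :: "nat \<Rightarrow> ((nat \<Rightarrow> complex) \<Rightarrow> complex) \<Rightarrow> (nat \<Rightarrow> complex) \<Rightarrow> complex" where
  "partial_deriv i f t = deriv (\<lambda>s. f (t(i := s))) (t i)"

definition critical_points ::
  "nat \<Rightarrow> (nat \<Rightarrow> complex) \<Rightarrow> (nat \<Rightarrow> nat) \<Rightarrow> nat \<Rightarrow> (nat \<Rightarrow> complex) set" where
  "critical_points n z m k =
     {t \<in> Phi_domain n z m k. Phi n z m k t \<noteq> 0 \<and>
        (\<forall>i\<in>{1..k}. 1 / Phi n z m k t * partial_deriv i (Phi n z m k) t = 0)}"

definition perm_orbit :: "nat \<Rightarrow> (nat \<Rightarrow> complex) \<Rightarrow> (nat \<Rightarrow> complex) set" where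
  "perm_orbit k t = {t \<circ> \<sigma> | \<sigma>. \<sigma> permutes {1..k}}"

definition critical_orbits ::
  "nat \<Rightarrow> (nat \<Rightarrow> complex) \<Rightarrow> (nat \<Rightarrow> nat) \<Rightarrow> nat \<Rightarrow> (nat \<Rightarrow> complex) set set" where
  "critical_orbits n z m k = perm_orbit k ` critical_points n z m k"

global_interpretation cpoly: vector_space "smult :: complex \<Rightarrow> complex poly \<Rightarrow> complex poly"
  by unfold_locales (simp_all add: smult_add_right smult_add_left)

definition is_plane :: "complex poly set \<Rightarrow> bool" where
  "is_plane V \<longleftrightarrow> cpoly.subspace V \<and> cpoly.dim V = 2 \<and> (\<exists>d. \<forall>P\<in>V. degree P \<le> d)"

definition plane_degree :: "complex poly set \<Rightarrow> nat" where
  "plane_degree V = Max (degree ` V)"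

definition plane_order :: "complex poly set \<Rightarrow> nat" where
  "plane_order V = Min (degree ` (V - {0}))"

definition wronskian :: "complex poly \<Rightarrow> complex poly \<Rightarrow> complex poly" where
  "wronskian F G =
     smult (1 / (of_nat (degree F) - of_nat (degree G))) (pderiv F * G - F * pderiv G)"

definition plane_wronskian :: "complex poly set \<Rightarrow> complex poly" where
  "plane_wronskian V = (THE w. \<exists>F\<in>V. \<exists>G\<in>V.
     lead_coeff F = 1 \<and> degree F = plane_order V \<and>
     lead_coeff G = 1 \<and> degree G = plane_degree V \<and> w = wronskian F G)"

definition generic_plane :: "complex poly set \<Rightarrow> bool" where
  "generic_plane V \<longleftrightarrow> is_plane V \<and> (\<forall>x0. \<exists>P\<in>V. poly P x0 \<noteq> 0)"

text \<open>The condition \<open>P \<noteq> 0\<close> matters for planes of order 0, since \<open>degree 0 = 0\<close>.\<close>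

definition nondegenerate_plane :: "complex poly set \<Rightarrow> bool" where
  "nondegenerate_plane V \<longleftrightarrow> generic_plane V \<and>
     (\<forall>P\<in>V. P \<noteq> 0 \<and> degree P = plane_order V \<longrightarrow> (\<forall>x. order x P \<le> 1))"

text \<open>The description in \<open>plane_wronskian\<close> is well defined: the choice of \<open>F\<close> and \<open>G\<close> is irrelevant.\<close>

lemma monic_diff_degree:
  fixes P Q :: "complex poly"
  assumes "lead_coeff P = 1" "lead_coeff Q = 1" "degree P = degree Q" "P \<noteq> Q"
  shows "degree (P - Q) < degree P"
proof -
  have "coeff (P - Q) (degree P) = 0" using assms by simp
  moreover have "degree (P - Q) \<le> degree P" using assms(3) by (simp add: degree_diff_le)
  moreover have "P - Q \<noteq> 0" using assms(4) by simp
  ultimately show ?thesis by (metis le_neq_implies_less leading_coeff_0_iff)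
qed

lemma plane_wronskian_unique:
  assumes V: "is_plane V"
    and F: "F \<in> V" "lead_coeff F = 1" "degree F = plane_order V"
    and G: "G \<in> V" "lead_coeff G = 1" "degree G = plane_degree V"
    and F': "F' \<in> V" "lead_coeff F' = 1" "degree F' = plane_order V"
    and G': "G' \<in> V" "lead_coeff G' = 1" "degree G' = plane_degree V"
  shows "wronskian F' G' = wronskian F G"
proof (cases "plane_order V = plane_degree V")
  case True
  then show ?thesis using F G F' G' by (simp add: wronskian_def)
next
  case False
  obtain d where d: "\<And>P. P \<in> V \<Longrightarrow> degree P \<le> d" using V by (auto simp: is_plane_def)
  have sub: "cpoly.subspace V" and dim: "cpoly.dim V = 2" using V by (auto simp: is_plane_def)
  have fin: "finite (degree ` (V - {0}))"
    by (rule finite_subset[of _ "{..d}"]) (use d in auto)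
  have fin2: "finite (degree ` V)"
    by (rule finite_subset[of _ "{..d}"]) (use d in auto)
  have less: "degree F < degree G"
  proof -
    have "degree F \<le> plane_degree V"
      unfolding plane_degree_def using fin2 F(1) by (intro Max_ge) auto
    then show ?thesis using False F(3) G(3) by linarith
  qed
  have FF: "F' = F"
  proof (rule ccontr)
    assume ne: "F' \<noteq> F"
    have "F' - F \<in> V - {0}" using ne F(1) F'(1) sub by (simp add: cpoly.subspace_diff)
    then have "plane_order V \<le> degree (F' - F)"
      unfolding plane_order_def using fin by (intro Min_le) auto
    then show False using monic_diff_degree[of F' F] ne F F' by simp
  qed
  obtain B where B: "B \<subseteq> V" "cpoly.independent B" "V \<subseteq> cpoly.span B" "card B = 2"
    using cpoly.basis_exists[of V] dim by metis
  have finB: "finite B" using B(4) by (metis card.infinite zero_neq_numeral)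
  have Fn: "F \<noteq> 0" using F(2) by auto
  have Gn: "G \<notin> cpoly.span {F}"
  proof
    assume "G \<in> cpoly.span {F}"
    then obtain c where "G = smult c F" by (auto simp: cpoly.span_singleton)
    then show False using less by (metis degree_smult_le not_le)
  qed
  have "G' \<in> cpoly.span {G, F}"
  proof (rule ccontr)
    assume G'n: "G' \<notin> cpoly.span {G, F}"
    have ind: "cpoly.independent {G', G, F}"
      using Fn Gn G'n by (intro cpoly.independent_insertI) (auto simp: cpoly.independent_empty)
    have "{G', G, F} \<subseteq> cpoly.span B" using B F(1) G(1) G'(1) by auto
    then have "card {G', G, F} \<le> 2"
      using cpoly.independent_span_bound[OF finB ind] B(4) by simp
    moreover have "card {G', G, F} = 3"
    proof -
      have "G \<noteq> F" using Gn cpoly.span_base[of F "{F}"] by auto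
      moreover have "G' \<noteq> G" "G' \<noteq> F"
        using G'n cpoly.span_base[of _ "{G, F}"] by auto
      ultimately show ?thesis by simp
    qed
    ultimately show False by simp
  qed
  then obtain p q where "G' - smult p G = smult q F"
    by (auto simp: cpoly.span_insert cpoly.span_singleton)
  then have eq: "G' = smult p G + smult q F" by (simp add: algebra_simps)
  have "coeff G' (degree G) = p"
    using less G(2) by (simp add: eq coeff_eq_0)
  then have "p = 1" using G'(2,3) G(3) by simp
  then have "G' = G + smult q F" using eq by simp
  then have "pderiv F * G' - F * pderiv G' = pderiv F * G - F * pderiv G"
    by (simp add: pderiv_add pderiv_smult algebra_simps)
  then show ?thesis using FF G(3) G'(3) by (simp add: wronskian_def)
qed

lemma plane_wronskian_eq:
  assumes "is_plane V"
    and "F \<in> V" "lead_coeff F = 1" "degree F = plane_order V"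
    and "G \<in> V" "lead_coeff G = 1" "degree G = plane_degree V"
  shows "plane_wronskian V = wronskian F G"
  unfolding plane_wronskian_def
  by (rule the_equality) (use assms plane_wronskian_unique[OF assms] in blast)+

end

theory Submission
  imports Defs "HOL-Computational_Algebra.Fundamental_Theorem_Algebra"
begin

text \<open>
  Put \<open>F = \<Prod>\<^sub>i (x - t\<^sub>i)\<close>. At a point \<open>t\<close> with distinct coordinates, none of them a root of \<open>W\<close>,
  the logarithmic derivative of \<open>\<Phi>\<close> in the \<open>i\<close>-th direction is \<open>F''(t\<^sub>i) / F'(t\<^sub>i) - W'(t\<^sub>i) / W(t\<^sub>i)\<close>,
  because \<open>F''(t\<^sub>i) / F'(t\<^sub>i)\<close> is the sum of \<open>2 / (t\<^sub>i - t\<^sub>j)\<close> over \<open>j \<noteq> i\<close>. Hence \<open>t\<close> is critical with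
  non-zero critical value exactly when its coordinates are distinct, avoid the roots of \<open>W\<close>, and
  \<open>F'' W - F' W'\<close> vanishes at each of them (\<open>critical_points_iff\<close>). This is a condition on the set of
  coordinates only, and the points with a given set of \<open>k\<close> distinct coordinates form one orbit. So
  the orbits correspond to the \<open>critical_root_sets\<close> (\<open>bij_betw_critical_root_sets_orbits\<close>).

  The same condition decides whether \<open>F' G - F G' = W\<close> has a polynomial solution \<open>G\<close>
  (\<open>wr_solution_iff\<close>). Formally \<open>G = - F \<integral> W / F\<^sup>2\<close>, and since the roots of \<open>F\<close> are simple,
  \<open>F'' W - F' W'\<close> vanishes at a root of \<open>F\<close> exactly when \<open>W / F\<^sup>2\<close> has no residue there, i.e. when the
  integral produces no logarithm. The proof avoids residues: interpolation makes \<open>F' G - F G' - W\<close>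
  divisible by \<open>F\<^sup>2\<close>, and adding to \<open>G\<close> the product of \<open>F\<close> and an antiderivative of the quotient
  cancels what is left.

  A solution \<open>G\<close> is unique up to multiples of \<open>F\<close>, since \<open>F' D = F D'\<close> forces \<open>D\<close> to be proportional to
  \<open>F\<close> (\<open>wr_eq_0_imp_proportional\<close>). Comparing degrees, after removing such a multiple \<open>G\<close> has degree
  \<open>|M| + 1 - k\<close>, which exceeds \<open>k\<close> because \<open>2 k \<le> |M|\<close>. So \<open>F\<close> and \<open>G\<close> span a plane with the prescribed
  order, degree and Wronskian, and this plane is determined by \<open>F\<close> and \<open>W\<close>. Conversely, if a
  nondegenerate plane has Wronskian \<open>W\<close> and \<open>F\<close> is its monic polynomial of smaller degree, then the
  roots of \<open>F\<close> are simple, and none of them is a root of \<open>W\<close>: a common root would be a root of every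
  polynomial in the plane. Therefore the roots of \<open>F\<close> form a critical root set
  (\<open>bij_betw_critical_root_sets_planes\<close>). The theorem composes the two bijections.
\<close>

section \<open>The Wronskian pairing\<close>

definition wr :: "complex poly \<Rightarrow> complex poly \<Rightarrow> complex poly" where
  "wr F G = pderiv F * G - F * pderiv G"

lemma wr_self [simp]: "wr F F = 0"
  by (simp add: wr_def)

lemma wr_0_right [simp]: "wr F 0 = 0"
  by (simp add: wr_def)

lemma wr_add_right: "wr F (G + H) = wr F G + wr F H"
  by (simp add: wr_def pderiv_add algebra_simps)

lemma wr_diff_right: "wr F (G - H) = wr F G - wr F H"
  by (simp add: wr_def pderiv_diff algebra_simps)

lemma wr_smult_right: "wr F (smult c G) = smult c (wr F G)"
  by (simp add: wr_def pderiv_smult algebra_simps smult_diff_right)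

lemma wr_mult_right: "wr F (F * Q) = - (F\<^sup>2 * pderiv Q)"
  by (simp add: wr_def pderiv_mult algebra_simps power2_eq_square)

lemma pderiv_wr: "pderiv (wr F G) = pderiv (pderiv F) * G - F * pderiv (pderiv G)"
  by (simp add: wr_def pderiv_diff pderiv_mult algebra_simps)

lemma wronskian_eq_wr:
  "wronskian F G = smult (1 / (of_nat (degree F) - of_nat (degree G))) (wr F G)"
  by (simp add: wronskian_def wr_def)

lemma coeff_mult_top:
  fixes p q :: "complex poly"
  assumes "degree p \<le> n" "degree q \<le> m"
  shows "coeff (p * q) (n + m) = coeff p n * coeff q m"
proof (cases "degree p = n \<and> degree q = m")
  case True
  then show ?thesis using coeff_mult_degree_sum[of p q] by auto
next
  case False
  then have "degree (p * q) < n + m" "coeff p n * coeff q m = 0"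
    using assms degree_mult_le[of p q] by (auto simp: coeff_eq_0)
  then show ?thesis by (simp add: coeff_eq_0)
qed

text \<open>Multiplying by \<open>x\<close>, which is \<open>pCons 0\<close>, turns \<open>pderiv\<close> into the operator that
scales the coefficient in degree \<open>j\<close> by \<open>j\<close>, so that the top coefficient of the Wronskian can be computed without treating constants separately.\<close>

lemma wr_shift:
  "pCons 0 (wr F G) = pCons 0 (pderiv F) * G - F * pCons 0 (pderiv G)"
  by (simp add: wr_def)

lemma degree_pCons_pderiv_le: "degree (pCons 0 (pderiv F)) \<le> degree (F :: complex poly)"
  by (cases "degree F = 0") (auto simp: degree_pderiv pderiv_eq_0_iff degree_pCons_eq_if)

lemma coeff_pCons_pderiv: "coeff (pCons 0 (pderiv F)) j = of_nat j * coeff F j"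
  by (cases j) (auto simp: coeff_pderiv)

lemma coeff_wr_top:
  assumes "degree F + degree G = Suc j"
  shows "coeff (wr F G) j
    = (of_nat (degree F) - of_nat (degree G)) * (lead_coeff F * lead_coeff G)"
proof -
  have "coeff (wr F G) j = coeff (pCons 0 (wr F G)) (degree F + degree G)"
    using assms by simp
  also have "\<dots> = (of_nat (degree F) - of_nat (degree G)) * (lead_coeff F * lead_coeff G)"
    unfolding wr_shift coeff_diff coeff_mult_top[OF degree_pCons_pderiv_le order.refl]
      coeff_mult_top[OF order.refl degree_pCons_pderiv_le] coeff_pCons_pderiv
    by (simp add: algebra_simps)
  finally show ?thesis .
qed

text \<open>Nonzero polynomials of different degrees never have vanishing Wronskian: the top coefficients of the two
products differ by the factor \<open>degree F - degree G\<close>.\<close>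

lemma degree_wr:
  assumes "F \<noteq> 0" "G \<noteq> 0" "degree F \<noteq> degree G"
  shows "Suc (degree (wr F G)) = degree F + degree G"
    and "lead_coeff (wr F G)
      = (of_nat (degree F) - of_nat (degree G)) * (lead_coeff F * lead_coeff G)"
proof -
  obtain j where j: "degree F + degree G = Suc j"
    using assms(3) by (metis add_is_0 not0_implies_Suc)
  have top: "coeff (wr F G) j \<noteq> 0" unfolding coeff_wr_top[OF j] using assms by simp
  have "degree (pCons 0 (wr F G)) \<le> degree F + degree G"
    unfolding wr_shift
    by (intro degree_diff_le order.trans[OF degree_mult_le] add_mono
        degree_pCons_pderiv_le order.refl)
  moreover have "wr F G \<noteq> 0" using top by auto
  ultimately have "degree (wr F G) \<le> j" using j by simp
  with le_degree[OF top] have "degree (wr F G) = j" by simp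
  then show "Suc (degree (wr F G)) = degree F + degree G"
    and "lead_coeff (wr F G)
      = (of_nat (degree F) - of_nat (degree G)) * (lead_coeff F * lead_coeff G)"
    using j coeff_wr_top[OF j] by simp_all
qed

text \<open>A vanishing Wronskian means that \<open>D / F\<close> is constant. Algebraically: subtract the multiple of \<open>F\<close> that
cancels the coefficient of \<open>D\<close> in degree \<open>degree F\<close>. What remains cannot have the degree of \<open>F\<close>, and its
Wronskian with \<open>F\<close> vanishes, so it is zero.\<close>

lemma wr_eq_0_imp_proportional:
  assumes "F \<noteq> 0" "wr F D = 0"
  shows "\<exists>c. D = smult c F"
proof -
  define c where "c = coeff D (degree F) / lead_coeff F"
  define R where "R = D - smult c F"
  have "coeff R (degree F) = 0" using assms(1) by (simp add: R_def c_def)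
  moreover have "wr F R = 0" using assms(2) by (simp add: R_def wr_diff_right wr_smult_right)
  ultimately have "R = 0"
    using degree_wr(2)[OF assms(1), of R] assms(1) by (metis eq_iff_diff_eq_0 leading_coeff_0_iff
      mult_eq_0_iff of_nat_eq_iff)
  then show ?thesis by (auto simp: R_def)
qed

section \<open>Polynomials with simple roots\<close>

definition root_poly :: "complex set \<Rightarrow> complex poly" where
  "root_poly A = (\<Prod>a\<in>A. [:- a, 1:])"

lemma poly_root_poly: "poly (root_poly A) x = (\<Prod>a\<in>A. x - a)"
  by (simp add: root_poly_def poly_prod)

lemma poly_root_poly_eq_0_iff: "finite A \<Longrightarrow> poly (root_poly A) x = 0 \<longleftrightarrow> x \<in> A"
  by (auto simp: poly_root_poly)

lemma lead_coeff_root_poly [simp]: "lead_coeff (root_poly A) = 1"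
  by (simp add: root_poly_def lead_coeff_prod)

lemma root_poly_nonzero [simp]: "root_poly A \<noteq> 0"
  using lead_coeff_root_poly[of A] by force

lemma degree_root_poly [simp]: "degree (root_poly A) = card A"
  by (simp add: root_poly_def degree_prod_eq_sum_degree)

lemma root_poly_remove:
  "finite A \<Longrightarrow> a \<in> A \<Longrightarrow> root_poly A = [:- a, 1:] * root_poly (A - {a})"
  unfolding root_poly_def by (rule prod.remove)

text \<open>With \<open>F = (x - a) R\<close> one has \<open>F' = R + (x - a) R'\<close> and \<open>F'' = 2 R' + (x - a) R''\<close>. The quotient
\<open>F'' / F' = 2 R' / R\<close> at \<open>a\<close> is what links \<open>\<Phi>\<close> to the Wronskian equation.\<close>

lemma poly_pderiv_root_poly:
  assumes "finite A" "a \<in> A"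
  shows "poly (pderiv (root_poly A)) a = poly (root_poly (A - {a})) a"
    and "poly (pderiv (pderiv (root_poly A))) a = 2 * poly (pderiv (root_poly (A - {a}))) a"
  by (simp_all add: root_poly_remove[OF assms] pderiv_mult pderiv_add pderiv_pCons
      del: mult_pCons_left)

lemma poly_pderiv_root_poly_nonzero:
  assumes "finite A" "a \<in> A"
  shows "poly (pderiv (root_poly A)) a \<noteq> 0"
  using assms by (simp add: poly_pderiv_root_poly poly_root_poly_eq_0_iff)

lemma root_poly_dvd:
  assumes "finite A" "\<And>a. a \<in> A \<Longrightarrow> poly N a = 0"
  shows "root_poly A dvd N"
  using assms
proof (induction A arbitrary: N rule: finite_induct)
  case empty
  then show ?case by (simp add: root_poly_def)
next
  case (insert b A)
  obtain M where M: "N = [:- b, 1:] * M"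
    using insert.prems[of b] by (auto simp: poly_eq_0_iff_dvd)
  have "poly M a = 0" if "a \<in> A" for a
    using insert.prems[of a] insert.hyps that by (auto simp: M)
  then have "root_poly A dvd M" by (rule insert.IH)
  moreover have "root_poly (insert b A) = [:- b, 1:] * root_poly A"
    using insert.hyps by (simp add: root_poly_def)
  ultimately show ?case unfolding M by (metis dvd_refl mult_dvd_mono)
qed

text \<open>Write \<open>N = F M\<close> with \<open>F = root_poly A\<close>. At a root of \<open>F\<close> the derivative of \<open>N\<close> is \<open>F' M\<close>, and \<open>F'\<close> does not
vanish there; so \<open>M\<close> vanishes on \<open>A\<close> as well.\<close>

lemma root_poly_square_dvd:
  assumes "finite A" "\<And>a. a \<in> A \<Longrightarrow> poly N a = 0" "\<And>a. a \<in> A \<Longrightarrow> poly (pderiv N) a = 0"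
  shows "(root_poly A)\<^sup>2 dvd N"
proof -
  obtain M where M: "N = root_poly A * M" using root_poly_dvd[of A N] assms by auto
  have "poly M a = 0" if "a \<in> A" for a
    using assms(3)[OF that] poly_pderiv_root_poly_nonzero[OF assms(1) that]
      poly_root_poly_eq_0_iff[OF assms(1), of a] that
    by (simp add: M pderiv_mult)
  then have "root_poly A dvd M" using assms(1) root_poly_dvd by blast
  then show ?thesis by (simp add: M power2_eq_square)
qed

lemma interpolating_poly:
  fixes v :: "complex \<Rightarrow> complex"
  assumes "finite A"
  shows "\<exists>P. \<forall>a\<in>A. poly P a = v a"
  using assms
proof (induction A rule: finite_induct)
  case empty
  then show ?case by simp
next
  case (insert b A)
  then obtain P where P: "\<forall>a\<in>A. poly P a = v a" by blast
  have nz: "poly (root_poly A) b \<noteq> 0" using insert.hyps by (simp add: poly_root_poly_eq_0_iff)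
  define P' where "P' = P + smult ((v b - poly P b) / poly (root_poly A) b) (root_poly A)"
  have "\<forall>a\<in>insert b A. poly P' a = v a"
    using P nz insert.hyps by (auto simp: P'_def poly_root_poly_eq_0_iff)
  then show ?case by blast
qed

lemma poly_antiderivative: "\<exists>Q :: complex poly. pderiv Q = p"
proof
  define Q where "Q = pCons 0 (Abs_poly (\<lambda>i. coeff p i / of_nat (Suc i)))"
  have "coeff (Abs_poly (\<lambda>i. coeff p i / of_nat (Suc i))) i = coeff p i / of_nat (Suc i)" for i
    by (subst Abs_poly_inverse) (auto intro!: always_eventually eventually_mono[OF MOST_coeff_eq_0[of p]])
  then show "pderiv Q = p"
    by (intro poly_eqI) (simp add: Q_def coeff_pderiv del: of_nat_Suc)
qed

lemma order_root_poly_le: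
  assumes "finite A"
  shows "order x (root_poly A) \<le> 1"
proof -
  have "rsquarefree (root_poly A)"
    unfolding rsquarefree_roots
    using assms poly_pderiv_root_poly_nonzero by (auto simp: poly_root_poly_eq_0_iff)
  then show ?thesis by (auto simp: rsquarefree_def le_Suc_eq)
qed

section \<open>Solvability of the Wronskian equation\<close>

text \<open>If \<open>W = F' G - F G'\<close> then \<open>W' = F'' G - F G''\<close>, and the condition follows by evaluating both at a root of
\<open>F\<close>. Conversely, at a root of \<open>F\<close> any solution must take the value \<open>W / F'\<close>. Start from an interpolating \<open>G\<close>
with these values; then \<open>N = F' G - F G' - W\<close> vanishes at the roots of \<open>F\<close>, and the condition says that
\<open>N'\<close> vanishes there too. So \<open>N = F\<^sup>2 M\<close>. Replacing \<open>G\<close> by \<open>G + F Q\<close> changes the Wronskian by \<open>- F\<^sup>2 Q'\<close>,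
hence an antiderivative \<open>Q\<close> of \<open>M\<close> corrects \<open>G\<close> to a solution.\<close>

lemma wr_solution_iff:
  assumes "finite A" "\<And>a. a \<in> A \<Longrightarrow> poly W a \<noteq> 0"
  defines "F \<equiv> root_poly A"
  shows "(\<exists>G. wr F G = W) \<longleftrightarrow>
    (\<forall>a\<in>A. poly (pderiv (pderiv F) * W - pderiv F * pderiv W) a = 0)"
proof safe
  fix G a assume "a \<in> A" and W: "W = wr F G"
  then have "poly F a = 0" using assms(1) by (simp add: F_def poly_root_poly_eq_0_iff)
  then show "poly (pderiv (pderiv F) * wr F G - pderiv F * pderiv (wr F G)) a = 0"
    by (simp only: pderiv_wr) (simp add: wr_def)
next
  assume crit: "\<forall>a\<in>A. poly (pderiv (pderiv F) * W - pderiv F * pderiv W) a = 0"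
  have F0: "poly F a = 0" if "a \<in> A" for a
    using that assms(1) by (simp add: F_def poly_root_poly_eq_0_iff)
  have F1: "poly (pderiv F) a \<noteq> 0" if "a \<in> A" for a
    using that assms(1) poly_pderiv_root_poly_nonzero by (simp add: F_def)
  obtain G where G: "\<forall>a\<in>A. poly G a = poly W a / poly (pderiv F) a"
    using interpolating_poly[OF assms(1), of "\<lambda>a. poly W a / poly (pderiv F) a"] by blast
  have "F\<^sup>2 dvd wr F G - W"
    unfolding F_def
  proof (rule root_poly_square_dvd[OF assms(1)], fold F_def)
    fix a assume a: "a \<in> A"
    show "poly (wr F G - W) a = 0"
      using a F0 F1 G by (simp add: wr_def)
    have "poly (pderiv (pderiv F)) a * poly W a = poly (pderiv F) a * poly (pderiv W) a"
      using crit a by simp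
    then show "poly (pderiv (wr F G - W)) a = 0"
      using a F0 F1[OF a] G by (simp add: pderiv_diff pderiv_wr nonzero_divide_eq_eq mult.commute)
  qed
  then obtain M where M: "wr F G - W = F\<^sup>2 * M" by blast
  obtain Q where "pderiv Q = M" using poly_antiderivative by blast
  then have "wr F (G + F * Q) = W" using M by (simp add: wr_add_right wr_mult_right algebra_simps)
  then show "\<exists>G. wr F G = W" ..
qed

text \<open>The coordinate sets of the critical points, described by the condition under which
\<open>wr_solution_iff\<close> provides a partner \<open>G\<close>.\<close>

definition critical_root_sets :: "complex poly \<Rightarrow> nat \<Rightarrow> complex set set" where
  "critical_root_sets W k = {A. finite A \<and> card A = k \<and>
     (\<forall>a\<in>A. poly W a \<noteq> 0 \<and>
       poly (pderiv (pderiv (root_poly A)) * W - pderiv (root_poly A) * pderiv W) a = 0)}"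

section \<open>Planes spanned by polynomials of different degrees\<close>

lemma independent_two_degrees:
  assumes "F \<noteq> 0" "degree F < degree G"
  shows "cpoly.independent {G, F}" and "card {G, F} = 2"
proof -
  have "G \<notin> cpoly.span {F}"
  proof
    assume "G \<in> cpoly.span {F}"
    then obtain c where "G = smult c F" by (auto simp: cpoly.span_singleton)
    then show False using assms(2) degree_smult_le[of c F] by simp
  qed
  then show "cpoly.independent {G, F}"
    using assms(1) by (intro cpoly.independent_insertI) (auto simp: cpoly.independent_empty)
  show "card {G, F} = 2" using assms(2) by (auto simp: card_2_iff)
qed

text \<open>Planes are given by the abstract condition that their dimension is 2. Two elements of different
degrees are independent, and a third independent one would exceed the dimension.\<close>

lemma plane_eq_span:
  assumes V: "is_plane V" and "F \<in> V" "G \<in> V" "F \<noteq> 0" "degree F < degree G"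
  shows "V = cpoly.span {G, F}"
proof
  have sub: "cpoly.subspace V" and dim: "cpoly.dim V = 2" using V by (auto simp: is_plane_def)
  then show "cpoly.span {G, F} \<subseteq> V" using assms by (intro cpoly.span_minimal) auto
  note ind = independent_two_degrees[OF assms(4,5)]
  obtain B where B: "V \<subseteq> cpoly.span B" "card B = 2"
    using cpoly.basis_exists[of V] dim by metis
  have finB: "finite B" using B(2) by (metis card.infinite zero_neq_numeral)
  show "V \<subseteq> cpoly.span {G, F}"
  proof (rule ccontr)
    assume "\<not> V \<subseteq> cpoly.span {G, F}"
    then obtain H where H: "H \<in> V" "H \<notin> cpoly.span {G, F}" by blast
    have "cpoly.independent (insert H {G, F})"
      by (rule cpoly.independent_insertI[OF H(2) ind(1)])
    moreover have "insert H {G, F} \<subseteq> cpoly.span B" using H B assms by auto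
    ultimately have "card (insert H {G, F}) \<le> 2"
      using cpoly.independent_span_bound[OF finB] B(2) by metis
    moreover have "H \<notin> {G, F}" using H(2) cpoly.span_base by blast
    ultimately show False using ind(2) by (simp add: card_insert_if)
  qed
qed

lemma in_span_two: "H \<in> cpoly.span {G, F} \<longleftrightarrow> (\<exists>p q. H = smult p G + smult q F)"
  by (auto simp: cpoly.span_insert cpoly.span_singleton algebra_simps)

lemma span_two_degrees:
  assumes "F \<noteq> 0" "degree F < degree G"
  shows "is_plane (cpoly.span {G, F})"
    and "plane_degree (cpoly.span {G, F}) = degree G"
    and "plane_order (cpoly.span {G, F}) = degree F"
    and "H \<in> cpoly.span {G, F} \<Longrightarrow> degree H \<le> degree F \<Longrightarrow> \<exists>q. H = smult q F"
proof -
  let ?V = "cpoly.span {G, F}"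
  have top: "degree (smult p G + smult q F) = degree G" if "p \<noteq> 0" for p q
    using that assms(2) by (simp add: degree_add_eq_left)
  have le: "degree P \<le> degree G" if "P \<in> ?V" for P
    using that assms(2) degree_add_le[of _ "degree G"] degree_smult_le
    by (auto simp: in_span_two intro!: degree_add_le order.trans[OF degree_smult_le])
  have low: "\<exists>q. H = smult q F" if HV: "H \<in> ?V" and le: "degree H \<le> degree F" for H
  proof -
    obtain p q where H: "H = smult p G + smult q F" using HV by (auto simp: in_span_two)
    then have "p = 0" using top[of p q] le assms(2) by fastforce
    then show ?thesis using H by auto
  qed
  then show "H \<in> ?V \<Longrightarrow> degree H \<le> degree F \<Longrightarrow> \<exists>q. H = smult q F" by blast
  show "is_plane ?V"
    unfolding is_plane_def using independent_two_degrees[OF assms] le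
    by (auto simp: cpoly.dim_span cpoly.dim_eq_card_independent)
  have fin: "finite (degree ` ?V)"
    by (rule finite_subset[of _ "{..degree G}"]) (use le in auto)
  have mem: "G \<in> ?V" "F \<in> ?V" by (simp_all add: cpoly.span_base)
  show "plane_degree ?V = degree G"
    unfolding plane_degree_def using fin le mem by (intro Max_eqI) auto
  have ge: "degree F \<le> degree P" if "P \<in> ?V - {0}" for P
    using low[of P] that by (cases "degree P \<le> degree F") auto
  show "plane_order ?V = degree F"
    unfolding plane_order_def
  proof (rule Min_eqI)
    show "finite (degree ` (?V - {0}))" by (rule finite_subset[OF _ fin]) auto
  qed (use ge mem assms(1) in auto)
qed

lemma plane_monic_basis:
  assumes V: "is_plane V" and less: "plane_order V < plane_degree V"
  obtains F G where "F \<in> V" "lead_coeff F = 1" "degree F = plane_order V"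
    "G \<in> V" "lead_coeff G = 1" "degree G = plane_degree V"
proof -
  obtain d where d: "\<And>P. P \<in> V \<Longrightarrow> degree P \<le> d" using V by (auto simp: is_plane_def)
  have sub: "cpoly.subspace V" and dim: "cpoly.dim V = 2" using V by (auto simp: is_plane_def)
  have fin: "finite (degree ` V)"
    by (rule finite_subset[of _ "{..d}"]) (use d in auto)
  have monic: "\<exists>Q\<in>V. lead_coeff Q = 1 \<and> degree Q = degree P" if "P \<in> V" "P \<noteq> 0" for P
    using that sub
    by (intro bexI[of _ "smult (inverse (lead_coeff P)) P"]) (auto simp: cpoly.subspace_scale)
  have "V - {0} \<noteq> {}"
  proof
    assume "V - {0} = {}"
    then have "V \<subseteq> cpoly.span {}" by auto
    then have "cpoly.dim V \<le> card ({} :: complex poly set)" by (intro cpoly.dim_le_card) auto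
    with dim show False by simp
  qed
  moreover have "finite (degree ` (V - {0}))"
    by (rule finite_subset[OF _ fin]) blast
  ultimately have "plane_order V \<in> degree ` (V - {0})"
    unfolding plane_order_def by (simp only: Min_in image_is_empty not_False_eq_True)
  then obtain P where P: "P \<in> V" "P \<noteq> 0" "degree P = plane_order V" by fastforce
  have "plane_degree V \<in> degree ` V"
    unfolding plane_degree_def using P(1) by (intro Max_in fin) blast
  then obtain Q where Q: "Q \<in> V" "degree Q = plane_degree V" by fastforce
  then have "Q \<noteq> 0" using less by auto
  then obtain G where "G \<in> V" "lead_coeff G = 1" "degree G = plane_degree V"
    using monic[OF Q(1)] Q(2) by auto
  moreover obtain F where "F \<in> V" "lead_coeff F = 1" "degree F = plane_order V"
    using monic[OF P(1,2)] P(3) by auto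
  ultimately show thesis using that by blast
qed

section \<open>Planes and critical root sets\<close>

text \<open>The plane attached to \<open>F\<close>, without a choice of a second generator: allowing the Wronskian with \<open>F\<close> to be
any multiple of \<open>W\<close> makes the set a subspace, and the multiple 0 puts \<open>F\<close> itself into it.\<close>

definition wr_plane :: "complex poly \<Rightarrow> complex poly \<Rightarrow> complex poly set" where
  "wr_plane W F = {G. \<exists>c. wr F G = smult c W}"

lemma wr_plane_eq_span:
  assumes "F \<noteq> 0" "wr F G = smult c W" "c \<noteq> 0"
  shows "wr_plane W F = cpoly.span {G, F}"
proof (intro equalityI subsetI)
  fix H assume "H \<in> wr_plane W F"
  then obtain d where "wr F H = smult d W" by (auto simp: wr_plane_def)
  then have "wr F (H - smult (d / c) G) = 0"
    using assms by (simp add: wr_diff_right wr_smult_right)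
  then obtain q where "H - smult (d / c) G = smult q F"
    using wr_eq_0_imp_proportional[OF assms(1)] by blast
  then have "H = smult (d / c) G + smult q F" by (simp add: algebra_simps)
  then show "H \<in> cpoly.span {G, F}" unfolding in_span_two by blast
next
  fix H assume "H \<in> cpoly.span {G, F}"
  then show "H \<in> wr_plane W F"
    using assms(2) by (auto simp: in_span_two wr_plane_def wr_add_right wr_smult_right)
qed

context
  fixes W :: "complex poly" and M k :: nat
  assumes W: "lead_coeff W = 1" "degree W = M" and k: "2 * k \<le> M"
begin

text \<open>If \<open>wr F G = W\<close> and \<open>degree G \<noteq> k\<close>, then the degree formula \<open>M + 1 = k + degree G\<close> determines the
degree of \<open>G\<close>. The degree \<open>k\<close> is excluded by subtracting a multiple of \<open>F\<close>.\<close>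

lemma wr_plane_of_critical_root_set:
  assumes A: "A \<in> critical_root_sets W k"
  obtains G where "lead_coeff G = 1" "degree G = M + 1 - k"
    "wronskian (root_poly A) G = W" "wr_plane W (root_poly A) = cpoly.span {G, root_poly A}"
proof -
  define F where "F = root_poly A"
  have F: "F \<noteq> 0" "degree F = k" "lead_coeff F = 1" "finite A"
    using A lead_coeff_root_poly[of A] by (simp_all add: F_def critical_root_sets_def)
  obtain H where H: "wr F H = W"
    using A wr_solution_iff[of A W] by (auto simp: F_def critical_root_sets_def)
  \<comment> \<open>No coefficient in degree \<open>k\<close> is left, so the degree of \<open>G\<close> is not \<open>k\<close>.\<close>
  define G where "G = H - smult (coeff H k) F"
  have G: "wr F G = W" using H by (simp add: G_def wr_diff_right wr_smult_right)
  have "G \<noteq> 0" using G W(1) by auto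
  moreover have "coeff G k = 0" using F by (simp add: G_def)
  ultimately have "degree F \<noteq> degree G" using F by (metis leading_coeff_0_iff)
  note deg = degree_wr[OF F(1) \<open>G \<noteq> 0\<close> this]
  have dG: "degree G = M + 1 - k" using deg(1) W F by (simp add: G)
  \<comment> \<open>The normalizing factor of \<open>wronskian\<close>; as \<open>W\<close> is monic, \<open>smult e G\<close> is monic too.\<close>
  define e :: complex where "e = of_nat k - of_nat (M + 1 - k)"
  have "k \<noteq> M + 1 - k" using k by linarith
  then have e: "e \<noteq> 0" unfolding e_def by (metis eq_iff_diff_eq_0 of_nat_eq_iff)
  have "e * lead_coeff G = 1" using deg(2) W F dG by (simp add: G e_def)
  moreover have wr: "wr F (smult e G) = smult e W" by (simp add: wr_smult_right G)
  moreover have "degree (smult e G) = M + 1 - k" using e dG by simp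
  moreover have "wronskian F (smult e G) = W"
    unfolding wronskian_eq_wr wr using e F(2) \<open>degree (smult e G) = M + 1 - k\<close>
    by (simp only: e_def[symmetric]) simp
  moreover have "lead_coeff (smult e G) = 1"
    using \<open>e * lead_coeff G = 1\<close> unfolding lead_coeff_smult .
  ultimately show thesis
    using wr_plane_eq_span[OF F(1) wr e] unfolding F_def by (intro that[of "smult e G"])
qed

text \<open>Let \<open>G\<close> be the second generator of the plane, next to \<open>F = root_poly A\<close>. Genericity holds because a
common root of \<open>F\<close> and \<open>G\<close> would be a root of their Wronskian \<open>W\<close>, whereas
\<open>W\<close> does not vanish at the roots of \<open>F\<close>. The last claim recovers \<open>F\<close> from the plane, which gives
injectivity below.\<close>

lemma wr_plane_properties:
  assumes A: "A \<in> critical_root_sets W k"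
  defines "V \<equiv> wr_plane W (root_poly A)"
  shows "nondegenerate_plane V" "plane_order V = k" "plane_degree V = M + 1 - k"
    "plane_wronskian V = W"
    and "P \<in> V \<Longrightarrow> degree P = k \<Longrightarrow> \<exists>q. P = smult q (root_poly A)"
proof -
  obtain G where G: "lead_coeff G = 1" "degree G = M + 1 - k"
    "wronskian (root_poly A) G = W" "V = cpoly.span {G, root_poly A}"
    using wr_plane_of_critical_root_set[OF A] unfolding V_def by blast
  have A': "finite A" "card A = k" "\<And>a. a \<in> A \<Longrightarrow> poly W a \<noteq> 0"
    using A by (auto simp: critical_root_sets_def)
  have less: "degree (root_poly A) < degree G" using G(2) A'(2) k by simp
  note V = span_two_degrees[OF root_poly_nonzero less, folded G(4)]
  have mem: "root_poly A \<in> V" "G \<in> V" using G(4) by (simp_all add: cpoly.span_base)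
  show ord: "plane_order V = k" and "plane_degree V = M + 1 - k"
    using V(2,3) A' G(2) by simp_all
  show low: "P \<in> V \<Longrightarrow> degree P = k \<Longrightarrow> \<exists>q. P = smult q (root_poly A)" for P
    using V(4) A' by simp
  show "plane_wronskian V = W"
    using plane_wronskian_eq[OF V(1) mem(1) lead_coeff_root_poly V(3)[symmetric]
        mem(2) G(1) V(2)[symmetric]] G(3) by (rule trans)
  have "\<exists>P\<in>V. poly P x \<noteq> 0" for x
  proof (rule ccontr)
    assume "\<not> (\<exists>P\<in>V. poly P x \<noteq> 0)"
    then have zero: "poly (root_poly A) x = 0" "poly G x = 0" using mem by blast+
    then have "poly W x = 0" unfolding G(3)[symmetric] wronskian_eq_wr wr_def by simp
    moreover have "x \<in> A" using zero(1) A'(1) by (simp add: poly_root_poly_eq_0_iff)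
    ultimately show False using A'(3) by blast
  qed
  then have "generic_plane V" using V(1) by (simp add: generic_plane_def)
  moreover have "order x P \<le> 1" if P: "P \<in> V" "P \<noteq> 0" "degree P = plane_order V" for x P
  proof -
    obtain q where "P = smult q (root_poly A)" using low P ord by metis
    then show ?thesis using P(2) order_root_poly_le[OF A'(1)] by (simp add: order_smult)
  qed
  ultimately show "nondegenerate_plane V" by (auto simp: nondegenerate_plane_def)
qed

text \<open>At a root \<open>a\<close> of \<open>F\<close> the Wronskian is \<open>F'(a) G(a)\<close> up to a factor. Nondegeneracy gives \<open>F'(a) \<noteq> 0\<close>, so
\<open>W(a) = 0\<close> would force \<open>G(a) = 0\<close> and contradict genericity.\<close>

lemma critical_root_set_of_plane:
  assumes V: "nondegenerate_plane V" "plane_order V = k" "plane_degree V = M + 1 - k"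
    "plane_wronskian V = W"
  obtains A where "A \<in> critical_root_sets W k" "V = wr_plane W (root_poly A)"
proof -
  have gen: "generic_plane V" and pl: "is_plane V"
    using V(1) by (auto simp: nondegenerate_plane_def generic_plane_def)
  have less: "plane_order V < plane_degree V" using V k by simp
  obtain F G where F: "F \<in> V" "lead_coeff F = 1" "degree F = plane_order V"
    and G: "G \<in> V" "lead_coeff G = 1" "degree G = plane_degree V"
    using plane_monic_basis[OF pl less] by blast
  have Fn: "F \<noteq> 0" using F(2) by auto
  have V_span: "V = cpoly.span {G, F}" using plane_eq_span[OF pl F(1) G(1) Fn] F G less by simp
  define e :: complex where "e = of_nat (degree F) - of_nat (degree G)"
  have "degree F \<noteq> degree G" using F G less by simp
  then have e: "e \<noteq> 0" unfolding e_def by (metis eq_iff_diff_eq_0 of_nat_eq_iff)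
  have W_eq: "W = smult (1 / e) (wr F G)"
    using plane_wronskian_eq[OF pl F G] V(4) by (simp add: wronskian_eq_wr e_def)
  have wr: "wr F G = smult e W" using e by (simp add: W_eq)
  have "order x F \<le> 1" for x using V(1) F Fn by (auto simp: nondegenerate_plane_def)
  then have sqf: "rsquarefree F" unfolding rsquarefree_def using Fn by (metis le_neq_implies_less less_one)
  define A where "A = {x. poly F x = 0}"
  have A: "finite A" using poly_roots_finite[OF Fn] by (simp add: A_def)
  have F_eq: "F = root_poly A"
    using complex_poly_decompose_rsquarefree[OF sqf] F(2) by (simp add: root_poly_def A_def)
  have card: "card A = k" using F(3) V(2) F_eq by (metis degree_root_poly)
  have Wn: "poly W a \<noteq> 0" if "a \<in> A" for a
  proof
    assume W0: "poly W a = 0"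
    have F0: "poly F a = 0" using that by (simp add: A_def)
    have "poly (wr F G) a = 0" using W0 by (simp add: wr)
    then have "poly (pderiv F) a * poly G a = 0" by (simp add: wr_def F0)
    moreover have "poly (pderiv F) a \<noteq> 0" using F0 sqf by (auto simp: rsquarefree_roots)
    ultimately have "poly P a = 0" if "P \<in> V" for P
      using that F0 by (auto simp: V_span in_span_two)
    then show False using gen by (auto simp: generic_plane_def)
  qed
  have "wr F (smult (1 / e) G) = W" by (simp add: wr_smult_right W_eq)
  then have "A \<in> critical_root_sets W k"
    using wr_solution_iff[OF A Wn] A card Wn
    by (auto simp: critical_root_sets_def F_eq[symmetric])
  moreover have "V = wr_plane W (root_poly A)"
    using wr_plane_eq_span[OF Fn wr e] V_span F_eq by simp
  ultimately show thesis by (rule that)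
qed

lemma bij_betw_critical_root_sets_planes:
  "bij_betw (\<lambda>A. wr_plane W (root_poly A)) (critical_root_sets W k)
     {V. nondegenerate_plane V \<and> plane_order V = k \<and> plane_degree V = M + 1 - k \<and>
         plane_wronskian V = W}"
proof (rule bij_betw_imageI)
  show "inj_on (\<lambda>A. wr_plane W (root_poly A)) (critical_root_sets W k)"
  proof (rule inj_onI)
    fix A B assume A: "A \<in> critical_root_sets W k" and B: "B \<in> critical_root_sets W k"
      and eq: "wr_plane W (root_poly A) = wr_plane W (root_poly B)"
    have fin: "finite A" "finite B" "card A = k" using A B by (auto simp: critical_root_sets_def)
    have "root_poly A \<in> wr_plane W (root_poly B)"
      unfolding eq[symmetric] by (auto simp: wr_plane_def intro: exI[of _ 0])
    then obtain q where q: "root_poly A = smult q (root_poly B)"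
      using wr_plane_properties(5)[OF B, of "root_poly A"] fin(3) by auto
    then have "q \<noteq> 0" by auto
    then have "x \<in> A \<longleftrightarrow> x \<in> B" for x
      using poly_root_poly_eq_0_iff[OF fin(1), of x] poly_root_poly_eq_0_iff[OF fin(2), of x]
      by (simp add: q)
    then show "A = B" by blast
  qed
next
  let ?T = "{V. nondegenerate_plane V \<and> plane_order V = k \<and> plane_degree V = M + 1 - k \<and>
         plane_wronskian V = W}"
  show "(\<lambda>A. wr_plane W (root_poly A)) ` critical_root_sets W k = ?T"
  proof (intro equalityI subsetI)
    fix V assume "V \<in> (\<lambda>A. wr_plane W (root_poly A)) ` critical_root_sets W k"
    then show "V \<in> ?T" using wr_plane_properties(1-4) by blast
  next
    fix V assume "V \<in> ?T"
    then show "V \<in> (\<lambda>A. wr_plane W (root_poly A)) ` critical_root_sets W k"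
      using critical_root_set_of_plane[of V] by blast
  qed
qed

end

section \<open>Critical points of \<Phi>\<close>

lemma W_poly_monic:
  shows "lead_coeff (W_poly n z m) = 1" and "degree (W_poly n z m) = (\<Sum>l = 1..n. m l)"
proof -
  show "lead_coeff (W_poly n z m) = 1"
    unfolding W_poly_def lead_coeff_prod lead_coeff_power by simp
  show "degree (W_poly n z m) = (\<Sum>l = 1..n. m l)"
    unfolding W_poly_def by (simp add: degree_prod_eq_sum_degree degree_power_eq)
qed

definition pairs :: "nat \<Rightarrow> (nat \<times> nat) set" where
  "pairs k = {(i, j). 1 \<le> i \<and> i < j \<and> j \<le> k}"

lemma finite_pairs [simp]: "finite (pairs k)"
  by (rule finite_subset[of _ "{1..k} \<times> {1..k}"]) (auto simp: pairs_def)

lemma Phi_eq: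
  "Phi n z m k t =
     (\<Prod>i = 1..k. inverse (poly (W_poly n z m) (t i))) * (\<Prod>(i, j) \<in> pairs k. (t i - t j)\<^sup>2)"
proof -
  have "(\<Prod>l = 1..n. (x - z l) powi (- int (m l))) = inverse (poly (W_poly n z m) x)" for x
    by (simp add: W_poly_def poly_prod poly_power power_int_minus prod_inversef[symmetric] o_def)
  then show ?thesis by (simp add: Phi_def pairs_def)
qed

lemma Phi_nonzero_iff:
  assumes "t \<in> Phi_domain n z m k"
  shows "Phi n z m k t \<noteq> 0 \<longleftrightarrow> inj_on t {1..k}"
proof -
  have "(\<Prod>i = 1..k. inverse (poly (W_poly n z m) (t i))) \<noteq> 0"
    using assms by (simp add: Phi_domain_def)
  moreover have "(\<Prod>(i, j) \<in> pairs k. (t i - t j)\<^sup>2) \<noteq> 0 \<longleftrightarrow> (\<forall>(i, j) \<in> pairs k. t i \<noteq> t j)"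
    by (auto simp: split_beta)
  moreover have "\<dots> \<longleftrightarrow> inj_on t {1..k}"
  proof
    assume ne: "\<forall>(i, j)\<in>pairs k. t i \<noteq> t j"
    show "inj_on t {1..k}"
    proof (rule linorder_inj_onI')
      show "t i \<noteq> t j" if "i \<in> {1..k}" "j \<in> {1..k}" "i < j" for i j
        using ne that by (auto simp: pairs_def)
    qed
  next
    assume "inj_on t {1..k}"
    then show "\<forall>(i, j)\<in>pairs k. t i \<noteq> t j" by (fastforce simp: pairs_def dest: inj_onD)
  qed
  ultimately show ?thesis by (simp add: Phi_eq)
qed

text \<open>As a function of a single coordinate, \<open>\<Phi>\<close> is \<open>R\<^sup>2 / W\<close> up to a non-zero constant, where \<open>R\<close> is the monic
polynomial whose roots are the other coordinates.\<close>

lemma Phi_upd: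
  assumes t: "inj_on t {1..k}" and i: "i \<in> {1..k}" and dom: "t \<in> Phi_domain n z m k"
  defines "W \<equiv> W_poly n z m" and "R \<equiv> root_poly (t ` {1..k} - {t i})"
  obtains C where "C \<noteq> 0" "\<And>s. Phi n z m k (t(i := s)) = C * ((poly R s)\<^sup>2 / poly W s)"
proof -
  let ?I = "{1..k} - {i}"
  define P0 where "P0 = {(a, b) \<in> pairs k. a \<noteq> i \<and> b \<noteq> i}"
  define P1 where "P1 = {(a, b) \<in> pairs k. a = i \<or> b = i}"
  have P: "pairs k = P0 \<union> P1" "P0 \<inter> P1 = {}" by (auto simp: P0_def P1_def)
  have fin: "finite P0" "finite P1" using finite_pairs[of k] unfolding P(1) by auto
  have R: "poly R s = (\<Prod>j\<in>?I. s - t j)" for s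
  proof -
    have "t ` {1..k} - {t i} = t ` ?I" using inj_on_image_set_diff[OF t, of "{1..k}" "{i}"] i by simp
    moreover have "inj_on t ?I" using t by (rule inj_on_subset) auto
    ultimately show ?thesis by (simp add: R_def poly_root_poly prod.reindex)
  qed
  have P1: "(\<Prod>(a, b)\<in>P1. ((t(i := s)) a - (t(i := s)) b)\<^sup>2) = (poly R s)\<^sup>2" for s
  proof -
    \<comment> \<open>The pairs that contain \<open>i\<close>, indexed by their other member; the squares hide the order.\<close>
    define h where "h j = (min i j, max i j)" for j
    have "P1 = h ` ?I"
    proof (intro equalityI subsetI)
      fix p assume "p \<in> P1"
      then obtain a b where p: "p = (a, b)" "1 \<le> a" "a < b" "b \<le> k" "a = i \<or> b = i"
        by (auto simp: P1_def pairs_def)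
      then have "p = h (if a = i then b else a)" "(if a = i then b else a) \<in> ?I"
        by (auto simp: h_def)
      then show "p \<in> h ` ?I" by (rule image_eqI)
    next
      fix p assume "p \<in> h ` ?I"
      then obtain j where "p = h j" "j \<in> ?I" by blast
      then show "p \<in> P1"
        using i by (cases "i < j") (auto simp: h_def P1_def pairs_def)
    qed
    moreover have "inj_on h ?I" by (auto simp: inj_on_def h_def min_def max_def split: if_splits)
    moreover have "(case h j of (a, b) \<Rightarrow> ((t(i := s)) a - (t(i := s)) b)\<^sup>2) = (s - t j)\<^sup>2"
      if "j \<in> ?I" for j
      using that by (cases "i < j") (auto simp: h_def power2_commute[of "t _" s])
    ultimately have "(\<Prod>(a, b)\<in>P1. ((t(i := s)) a - (t(i := s)) b)\<^sup>2) = (\<Prod>j\<in>?I. (s - t j)\<^sup>2)"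
      by (simp add: prod.reindex)
    then show ?thesis by (simp add: R prod_power_distrib)
  qed
  have P0: "(\<Prod>(a, b)\<in>P0. ((t(i := s)) a - (t(i := s)) b)\<^sup>2) = (\<Prod>(a, b)\<in>P0. (t a - t b)\<^sup>2)" for s
    by (rule prod.cong[OF refl]) (clarsimp simp: P0_def)
  define C where "C = (\<Prod>j\<in>?I. inverse (poly W (t j))) * (\<Prod>(a, b)\<in>P0. (t a - t b)\<^sup>2)"
  have "C \<noteq> 0"
  proof -
    have "t a \<noteq> t b" if "(a, b) \<in> P0" for a b
      using that inj_onD[OF t, of a b] by (auto simp: P0_def pairs_def)
    then show ?thesis
      using dom fin by (simp add: C_def Phi_domain_def W_def split_beta)
  qed
  moreover have "Phi n z m k (t(i := s)) = C * ((poly R s)\<^sup>2 / poly W s)" for s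
  proof -
    have "(\<Prod>j = 1..k. inverse (poly W ((t(i := s)) j)))
        = inverse (poly W s) * (\<Prod>j\<in>?I. inverse (poly W (t j)))"
      using i by (subst prod.remove[of _ i]) simp_all
    then show ?thesis
      unfolding Phi_eq W_def[symmetric] P(1) prod.union_disjoint[OF fin P(2)] P0 P1
      by (simp add: C_def divide_inverse)
  qed
  ultimately show thesis by (rule that)
qed

text \<open>The derivative of \<open>C R\<^sup>2 / W\<close> is \<open>C R (2 R' W - R W') / W\<^sup>2\<close>. At \<open>t\<^sub>i\<close> one has \<open>R = F'\<close> and
\<open>2 R' = F''\<close>, so the bracket is \<open>F'' W - F' W'\<close>, and \<open>C\<close>, \<open>R\<close> and \<open>W\<close> do not vanish.\<close>

lemma partial_deriv_Phi_eq_0_iff: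
  assumes t: "inj_on t {1..k}" and i: "i \<in> {1..k}" and dom: "t \<in> Phi_domain n z m k"
  defines "W \<equiv> W_poly n z m" and "F \<equiv> root_poly (t ` {1..k})"
  shows "partial_deriv i (Phi n z m k) t = 0 \<longleftrightarrow>
    poly (pderiv (pderiv F) * W - pderiv F * pderiv W) (t i) = 0"
proof -
  define R where "R = root_poly (t ` {1..k} - {t i})"
  obtain C where C: "C \<noteq> 0" "\<And>s. Phi n z m k (t(i := s)) = C * ((poly R s)\<^sup>2 / poly W s)"
    using Phi_upd[OF t i dom] unfolding R_def W_def by blast
  have W: "poly W (t i) \<noteq> 0" using dom i by (simp add: Phi_domain_def W_def)
  have R: "poly R (t i) \<noteq> 0" by (simp add: R_def poly_root_poly_eq_0_iff)
  have F: "poly (pderiv F) (t i) = poly R (t i)"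
    "poly (pderiv (pderiv F)) (t i) = 2 * poly (pderiv R) (t i)"
    using i by (simp_all add: F_def R_def poly_pderiv_root_poly)
  have "((\<lambda>s. C * ((poly R s)\<^sup>2 / poly W s)) has_field_derivative
      C * (poly R (t i) / (poly W (t i))\<^sup>2) *
        (2 * poly (pderiv R) (t i) * poly W (t i) - poly R (t i) * poly (pderiv W) (t i))) (at (t i))"
    using W by (auto intro!: derivative_eq_intros simp: field_simps power2_eq_square)
  then have "partial_deriv i (Phi n z m k) t = C * (poly R (t i) / (poly W (t i))\<^sup>2) *
        (2 * poly (pderiv R) (t i) * poly W (t i) - poly R (t i) * poly (pderiv W) (t i))"
    unfolding partial_deriv_def C(2) by (rule DERIV_imp_deriv)
  then show ?thesis using C(1) W R by (simp add: F)
qed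

lemma critical_points_iff:
  "t \<in> critical_points n z m k \<longleftrightarrow>
     t \<in> {1..k} \<rightarrow>\<^sub>E UNIV \<and> inj_on t {1..k} \<and> t ` {1..k} \<in> critical_root_sets (W_poly n z m) k"
proof (cases "t \<in> Phi_domain n z m k \<and> inj_on t {1..k}")
  case True
  then have dom: "t \<in> Phi_domain n z m k" and inj: "inj_on t {1..k}" by auto
  have "Phi n z m k t \<noteq> 0" using Phi_nonzero_iff[OF dom] inj by simp
  then show ?thesis
    using dom inj partial_deriv_Phi_eq_0_iff[OF inj _ dom]
    by (auto simp: critical_points_def critical_root_sets_def Phi_domain_def card_image)
next
  case False
  then show ?thesis
    using Phi_nonzero_iff[of t n z m k]
    by (auto simp: critical_points_def critical_root_sets_def Phi_domain_def)
qed

section \<open>Orbits of critical points\<close>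

definition enumerations :: "nat \<Rightarrow> complex set \<Rightarrow> (nat \<Rightarrow> complex) set" where
  "enumerations k A = {t \<in> {1..k} \<rightarrow>\<^sub>E UNIV. bij_betw t {1..k} A}"

text \<open>Two injective enumerations \<open>t\<close> and \<open>u\<close> of the same set differ by the permutation \<open>t\<^sup>-\<^sup>1 \<circ> u\<close>. An orbit
is thus determined by the set of coordinates of its points.\<close>

lemma perm_orbit_eq_enumerations:
  assumes t: "t \<in> {1..k} \<rightarrow>\<^sub>E UNIV" "inj_on t {1..k}"
  shows "perm_orbit k t = enumerations k (t ` {1..k})"
proof (intro equalityI subsetI)
  fix u assume "u \<in> perm_orbit k t"
  then obtain \<sigma> where \<sigma>: "\<sigma> permutes {1..k}" "u = t \<circ> \<sigma>" by (auto simp: perm_orbit_def)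
  have "bij_betw u {1..k} (t ` {1..k})"
    unfolding \<sigma>(2)
    by (rule bij_betw_trans[OF permutes_imp_bij[OF \<sigma>(1)] inj_on_imp_bij_betw[OF t(2)]])
  moreover have "u j = undefined" if "j \<notin> {1..k}" for j
    using that t(1) \<sigma> permutes_not_in[OF \<sigma>(1) that] by (auto simp: PiE_def extensional_def)
  ultimately show "u \<in> enumerations k (t ` {1..k})"
    by (auto simp: enumerations_def PiE_def extensional_def)
next
  fix u assume "u \<in> enumerations k (t ` {1..k})"
  then have u: "u \<in> {1..k} \<rightarrow>\<^sub>E UNIV" "bij_betw u {1..k} (t ` {1..k})"
    by (auto simp: enumerations_def)
  define \<sigma> where "\<sigma> j = (if j \<in> {1..k} then inv_into {1..k} t (u j) else j)" for j
  have "bij_betw (inv_into {1..k} t \<circ> u) {1..k} {1..k}"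
    using u(2) bij_betw_inv_into[OF inj_on_imp_bij_betw[OF t(2)]] by (rule bij_betw_trans)
  then have "bij_betw \<sigma> {1..k} {1..k}"
    by (rule bij_betw_cong[THEN iffD1, rotated]) (simp add: \<sigma>_def)
  then have "\<sigma> permutes {1..k}"
    by (rule bij_imp_permutes) (auto simp: \<sigma>_def)
  moreover have "u = t \<circ> \<sigma>"
  proof
    fix j show "u j = (t \<circ> \<sigma>) j"
    proof (cases "j \<in> {1..k}")
      case True
      then have "u j \<in> t ` {1..k}" using u(2) by (auto simp: bij_betw_def)
      then show ?thesis using True by (simp add: \<sigma>_def f_inv_into_f del: image_eqI)
    next
      case False
      then show ?thesis using u(1) t(1) by (auto simp: \<sigma>_def PiE_def extensional_def)
    qed
  qed
  ultimately show "u \<in> perm_orbit k t" by (auto simp: perm_orbit_def)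
qed

lemma enumeration_exists:
  assumes "finite A" "card A = k"
  obtains t where "t \<in> enumerations k A"
proof -
  obtain h where h: "bij_betw h {1..k} A"
    using ex_bij_betw_nat_finite_1[OF assms(1)] assms(2) by auto
  then have "bij_betw (restrict h {1..k}) {1..k} A"
    by (rule bij_betw_cong[THEN iffD1, rotated]) simp
  then show thesis by (intro that[of "restrict h {1..k}"]) (auto simp: enumerations_def)
qed

lemma bij_betw_critical_root_sets_orbits:
  "bij_betw (enumerations k) (critical_root_sets (W_poly n z m) k) (critical_orbits n z m k)"
proof (rule bij_betw_imageI)
  let ?S = "critical_root_sets (W_poly n z m) k"
  have ex: "\<exists>t. t \<in> enumerations k A" if "A \<in> ?S" for A
    using that enumeration_exists[of A k] by (auto simp: critical_root_sets_def)
  have img: "t ` {1..k} = A" if "t \<in> enumerations k A" for t A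
    using that by (simp add: enumerations_def bij_betw_def)
  show "inj_on (enumerations k) ?S"
    by (rule inj_onI) (metis ex img)
  show "enumerations k ` ?S = critical_orbits n z m k"
  proof (intro equalityI subsetI)
    fix X assume "X \<in> enumerations k ` ?S"
    then obtain A where A: "A \<in> ?S" "X = enumerations k A" by blast
    obtain t where "t \<in> enumerations k A" using ex[OF A(1)] by blast
    then have t: "t \<in> {1..k} \<rightarrow>\<^sub>E UNIV" "inj_on t {1..k}" "t ` {1..k} = A"
      by (auto simp: enumerations_def bij_betw_def)
    then have "t \<in> critical_points n z m k" using A(1) by (simp add: critical_points_iff)
    moreover have "X = perm_orbit k t"
      using perm_orbit_eq_enumerations[OF t(1,2)] t(3) A(2) by simp
    ultimately show "X \<in> critical_orbits n z m k" by (simp add: critical_orbits_def)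
  next
    fix X assume "X \<in> critical_orbits n z m k"
    then show "X \<in> enumerations k ` ?S"
      by (auto simp: critical_orbits_def critical_points_iff perm_orbit_eq_enumerations)
  qed
qed

section \<open>The correspondence\<close>

theorem corollary2:
  fixes n k :: nat and z :: "nat \<Rightarrow> complex" and m :: "nat \<Rightarrow> nat"
  assumes "inj_on z {1..n}"
    and "1 \<le> k" and "real k \<le> real (\<Sum>l = 1..n. m l) / 2"
  shows "\<exists>f. bij_betw f (critical_orbits n z m k)
           {V. nondegenerate_plane V \<and> plane_order V = k \<and>
               plane_degree V = (\<Sum>l = 1..n. m l) + 1 - k \<and>
               plane_wronskian V = W_poly n z m}"
proof -
  have "real (2 * k) \<le> real (\<Sum>l = 1..n. m l)" using assms(3) by simp
  then have "2 * k \<le> (\<Sum>l = 1..n. m l)" by (simp only: of_nat_le_iff)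
  note planes = bij_betw_critical_root_sets_planes[OF W_poly_monic this, of z]
  note orbits = bij_betw_inv_into[OF bij_betw_critical_root_sets_orbits[of k n z m]]
  show ?thesis using bij_betw_trans[OF orbits planes] by blast
qed

end
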